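(* Let $\omega_0\in[0,\pi]$, let $h>0$ with $h\omega_0\in[0,\pi]$, and let $m>1$ be an integer. Then $S^1_{\mathcal{E}_4}(h\mathbb{Z})\subset S^1_{\mathcal{E}_4}(\tfrac hm\mathbb{Z})$, and the generators satisfy, for all $x\in\mathbb{R}$, the two-scale relation $$\boldsymbol\phi^{h}_{\omega_0}(x)=\sum_{n\in\mathbb{Z}}\mathbf{H}_{h\to h/m}[n]\,\boldsymbol\phi^{h/m}_{\omega_0}\Big(x-n\frac hm\Big),$$ with refinement mask $$\mathbf{H}_{h\to h/m}[n]=\begin{bmatrix}\phi^h_{1,\omega_0}(n\frac hm)&(\phi^h_{1,\omega_0})'(n\frac hm)\\ \phi^h_{2,\omega_0}(n\frac hm)&(\phi^h_{2,\omega_0})'(n\frac hm)\end{bmatrix}=\begin{bmatrix}\phi_{1,h\omega_0}(\frac nm)&\frac1h(\phi_{1,h\omega_0})'(\frac nm)\\ h\,\phi_{2,h\omega_0}(\frac nm)&(\phi_{2,h\omega_0})'(\frac nm)\end{bmatrix}.$$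
   Context: For $\omega_0\in(0,\pi]$ put $$s(\omega_0)=2\sin(\omega_0/2)-\omega_0\cos(\omega_0/2),\qquad t(\omega_0)=2\sin(\omega_0/2)+\omega_0\cos(\omega_0/2),$$ $$u(\omega_0)=\omega_0\sin(\omega_0)-2(1-\cos(\omega_0)),\qquad v(\omega_0)=2\sin(\omega_0)+\omega_0(1-\cos(\omega_0)),$$ and let $\chi_{[0,1]}$ be the indicator function of $[0,1]$. Define $$g_{1,\omega_0}(x)=\Big(1-\tfrac{\sin(\omega_0/2)}{s(\omega_0)}+\tfrac{\omega_0\cos(\omega_0/2)}{s(\omega_0)}x+\tfrac{\sin(\omega_0/2-\omega_0x)}{s(\omega_0)}\Big)\chi_{[0,1]}(x),$$ $$g_{2,\omega_0}(x)=\Big(\tfrac{\sin(\omega_0)-\omega_0\cos(\omega_0)}{\omega_0u(\omega_0)}+\tfrac{\sin(\omega_0/2)}{s(\omega_0)}x-\tfrac{\omega_0^2\cos(\omega_0/2)\cos(\omega_0(1-x))+\sin(\omega_0/2)\big(\sin(\omega_0x)u(\omega_0)-\cos(\omega_0x)v(\omega_0)\big)}{2\omega_0\sin(\omega_0/2)s(\omega_0)t(\omega_0)}\Big)\chi_{[0,1]}(x).$$ The generators are $\phi_{1,\omega_0}(x)=g_{1,\omega_0}(x)$ for $x\ge0$, $\phi_{1,\omega_0}(x)=g_{1,\omega_0}(-x)$ for $x<0$; and $\phi_{2,\omega_0}(x)=g_{2,\omega_0}(x)$ for $x\ge0$, $\phi_{2,\omega_0}(x)=-g_{2,\omega_0}(-x)$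 for $x<0$. They are continuously differentiable on $\mathbb{R}$. On $[0,1]$, $\phi_{1,\omega_0}$ and $\phi_{2,\omega_0}$ are the elements of $\mathrm{span}\{1,x,e^{i\omega_0x},e^{-i\omega_0x}\}$ with $\phi_1(0)=1,\phi_1'(0)=\phi_1(1)=\phi_1'(1)=0$ and $\phi_2'(0)=1,\phi_2(0)=\phi_2(1)=\phi_2'(1)=0$, respectively. For $\omega_0=0$ the functions are understood as the limits as $\omega_0\to0$: $g_{1,0}(x)=(2x+1)(x-1)^2\chi_{[0,1]}(x)$ and $g_{2,0}(x)=x(x-1)^2\chi_{[0,1]}(x)$, with the same symmetric and antisymmetric extensions. For $h>0$ the re-scaled generators $\boldsymbol\phi^h_{\omega_0}=(\phi^h_{1,\omega_0},\phi^h_{2,\omega_0})^T$ are $\phi^h_{1,\omega_0}(x)=\phi_{1,h\omega_0}(x/h)$ and $\phi^h_{2,\omega_0}(x)=h\,\phi_{2,h\omega_0}(x/h)$. The Hermite spline space at resolution $h$ is $$S^1_{\mathcal{E}_4}(h\mathbb{Z})=\Big\{\sum_{n\in\mathbb{Z}}\mathbf{a}_h^T[n]\,\boldsymbol\phi^h_{\omega_0}(x-nh):\ \mathbf{a}_h\in\ell_2^{2\times1}(\mathbb{Z})\Big\},$$ where $\ell_2^{2\times1}(\mathbb{Z})$ is the space of square-summable sequences of $2\times1$ vectors. *)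

theory Defs
  imports "HOL-Analysis.Analysis"
begin

definition s_coef :: "real \<Rightarrow> real" where
  "s_coef w = 2 * sin (w / 2) - w * cos (w / 2)"

definition t_coef :: "real \<Rightarrow> real" where
  "t_coef w = 2 * sin (w / 2) + w * cos (w / 2)"

definition u_coef :: "real \<Rightarrow> real" where
  "u_coef w = w * sin w - 2 * (1 - cos w)"

definition v_coef :: "real \<Rightarrow> real" where
  "v_coef w = 2 * sin w + w * (1 - cos w)"

text \<open>The case \<open>w = 0\<close> is the limit of the trigonometric expressions as \<open>w\<close> tends to 0.\<close>

definition g1 :: "real \<Rightarrow> real \<Rightarrow> real" where
  "g1 w x =
    (if w = 0 then (2 * x + 1) * (x - 1)^2
     else 1 - sin (w / 2) / s_coef w + w * cos (w / 2) / s_coef w * x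
            + sin (w / 2 - w * x) / s_coef w)
    * indicator {0..1} x"

definition g2 :: "real \<Rightarrow> real \<Rightarrow> real" where
  "g2 w x =
    (if w = 0 then x * (x - 1)^2
     else (sin w - w * cos w) / (w * u_coef w) + sin (w / 2) / s_coef w * x
          - (w^2 * cos (w / 2) * cos (w * (1 - x))
               + sin (w / 2) * (sin (w * x) * u_coef w - cos (w * x) * v_coef w))
            / (2 * w * sin (w / 2) * s_coef w * t_coef w))
    * indicator {0..1} x"

definition phi1 :: "real \<Rightarrow> real \<Rightarrow> real" where
  "phi1 w x = (if x \<ge> 0 then g1 w x else g1 w (- x))"

definition phi2 :: "real \<Rightarrow> real \<Rightarrow> real" where
  "phi2 w x = (if x \<ge> 0 then g2 w x else - g2 w (- x))"

definition phi1_scaled :: "real \<Rightarrow> real \<Rightarrow> real \<Rightarrow> real" where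
  "phi1_scaled w h x = phi1 (h * w) (x / h)"

definition phi2_scaled :: "real \<Rightarrow> real \<Rightarrow> real \<Rightarrow> real" where
  "phi2_scaled w h x = h * phi2 (h * w) (x / h)"

definition phi_scaled :: "real \<Rightarrow> real \<Rightarrow> real \<Rightarrow> real^2" where
  "phi_scaled w h x = vector [phi1_scaled w h x, phi2_scaled w h x]"

text \<open>The scalar type ranges over \<open>real_normed_field\<close>, so that real and complex coefficient
  sequences are both covered. The generators are real-valued, hence the scalar multiplication.
  The series is taken pointwise; it has only finitely many nonzero terms at every point.\<close>

definition hermite_spline_space :: "real \<Rightarrow> real \<Rightarrow> (real \<Rightarrow> 'a::real_normed_field) set" where
  "hermite_spline_space w h =
    {f. \<exists>a :: int \<Rightarrow> 'a^2.
          (\<lambda>n. (norm (a n))^2) summable_on UNIV \<and>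
          (\<forall>x. ((\<lambda>n. \<Sum>i\<in>UNIV. (phi_scaled w h (x - of_int n * h) $ i) *\<^sub>R (a n $ i))
                 has_sum f x) UNIV)}"

definition refinement_mask :: "real \<Rightarrow> real \<Rightarrow> nat \<Rightarrow> int \<Rightarrow> real^2^2" where
  "refinement_mask w h m n =
    vector [vector [phi1_scaled w h (of_int n * (h / m)), deriv (phi1_scaled w h) (of_int n * (h / m))],
            vector [phi2_scaled w h (of_int n * (h / m)), deriv (phi2_scaled w h) (of_int n * (h / m))]]"

end

theory Submission
  imports Defs
begin

text \<open>
  The two-scale relation is Hermite interpolation on the fine grid. Whatever the resolution, the
  generators are continuously differentiable and consist of pieces from one fixed
  four-dimensional space, spanned by \<open>1\<close>, \<open>x\<close>, \<open>cos (\<omega> x)\<close>, \<open>sin (\<omega> x)\<close>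
  (the cubic polynomials for \<open>\<omega> = 0\<close>): the frequency \<open>h \<omega>\<close> of the
  unscaled generator compensates the dilation by \<open>h\<close> (\<open>spline_piece_dilate\<close>). An element of this space
  is determined on an interval of length \<open>k\<close> by its values and slopes at the two end points, provided
  \<open>k \<omega> \<le> pi\<close> (\<open>spline_piece_unisolvent\<close>), and the generators of step \<open>k\<close> and their
  translates form the basis dual to these data (\<open>hermite_interpolation\<close>).

  The knots of a generator of step \<open>h\<close> belong to the grid of step \<open>h / m\<close>, so on each fine cell this
  generator is a single element of the space. It equals its Hermite interpolant there, and the
  coefficients of the interpolant, the values and slopes at the fine grid points, are the
  entries of the mask (\<open>phi_scaled_refinement\<close>). Continuity of the derivative is essential: it
  makes the slope of the piece on either side of a grid point equal to the derivative of the generator.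

  For the inclusion of the spline spaces (\<open>hermite_spline_space_refine\<close>) this identity is inserted
  into the series of a coarse spline. Each fine coefficient is a combination of two
  neighbouring coarse ones, with weights depending on the residue of the index modulo \<open>m\<close>, and so
  square summability is preserved.
\<close>

section \<open>Exponential-polynomial pieces\<close>

text \<open>Membership of \<open>p\<close> in the four-dimensional space spanned by \<open>1\<close>, \<open>x\<close>, \<open>cos (w x)\<close>, \<open>sin (w x)\<close>, which
  is spanned over the complex numbers by \<open>1\<close>, \<open>x\<close> and the exponentials of \<open>\<plusminus> i w x\<close>, or in the space
  of cubic polynomials for \<open>w = 0\<close>. The derivative is carried along so that the closure properties
  below transport Hermite data at the same time.\<close>

definition spline_piece :: "real \<Rightarrow> (real \<Rightarrow> real) \<Rightarrow> (real \<Rightarrow> real) \<Rightarrow> bool" where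
  "spline_piece w p p' \<longleftrightarrow> (\<exists>a b c d. \<forall>x.
     if w = 0 then p x = a + b * x + c * x^2 + d * x^3 \<and> p' x = b + 2 * c * x + 3 * d * x^2
     else p x = a + b * x + c * cos (w * x) + d * sin (w * x) \<and>
          p' x = b - c * w * sin (w * x) + d * w * cos (w * x))"

lemma spline_piece_cubicI:
  assumes "\<And>x. p x = a + b * x + c * x^2 + d * x^3" "\<And>x. p' x = b + 2 * c * x + 3 * d * x^2"
  shows "spline_piece 0 p p'"
  unfolding spline_piece_def using assms by auto

lemma spline_piece_trigI:
  assumes "w \<noteq> 0" "\<And>x. p x = a + b * x + c * cos (w * x) + d * sin (w * x)"
    "\<And>x. p' x = b - c * w * sin (w * x) + d * w * cos (w * x)"
  shows "spline_piece w p p'"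
  unfolding spline_piece_def using assms by auto

lemma spline_piece_cases [consumes 1, case_names cubic trig]:
  assumes "spline_piece w p p'"
  obtains a b c d where "w = 0" "\<And>x. p x = a + b * x + c * x^2 + d * x^3"
      "\<And>x. p' x = b + 2 * c * x + 3 * d * x^2"
  | a b c d where "w \<noteq> 0" "\<And>x. p x = a + b * x + c * cos (w * x) + d * sin (w * x)"
      "\<And>x. p' x = b - c * w * sin (w * x) + d * w * cos (w * x)"
  using assms unfolding spline_piece_def by (cases "w = 0") auto

lemma spline_piece_has_derivative:
  assumes "spline_piece w p p'"
  shows "(p has_real_derivative p' x) (at x)"
  using assms
proof (cases rule: spline_piece_cases)
  case (cubic a b c d)
  have "p = (\<lambda>x. a + b * x + c * x^2 + d * x^3)"
    using cubic by auto
  then show ?thesis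
    unfolding cubic(3) by (auto intro!: derivative_eq_intros simp: algebra_simps)
next
  case (trig a b c d)
  have "p = (\<lambda>x. a + b * x + c * cos (w * x) + d * sin (w * x))"
    using trig by auto
  then show ?thesis
    unfolding trig(3) by (auto intro!: derivative_eq_intros simp: algebra_simps)
qed

lemma spline_piece_0: "spline_piece w (\<lambda>x. 0) (\<lambda>x. 0)"
  unfolding spline_piece_def by (intro exI[of _ 0]) auto

lemma spline_piece_add:
  assumes "spline_piece w p p'" "spline_piece w q q'"
  shows "spline_piece w (\<lambda>x. p x + q x) (\<lambda>x. p' x + q' x)"
  using assms(1)
proof (cases rule: spline_piece_cases)
  case p: (cubic a b c d)
  from assms(2) show ?thesis
  proof (cases rule: spline_piece_cases)
    case (cubic a2 b2 c2 d2)
    show ?thesis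
      unfolding \<open>w = 0\<close>
      by (rule spline_piece_cubicI[of _ "a + a2" "b + b2" "c + c2" "d + d2"])
        (simp_all add: p cubic algebra_simps)
  qed (simp add: p)
next
  case p: (trig a b c d)
  from assms(2) show ?thesis
  proof (cases rule: spline_piece_cases)
    case (trig a2 b2 c2 d2)
    show ?thesis
      by (rule spline_piece_trigI[of _ _ "a + a2" "b + b2" "c + c2" "d + d2"])
        (simp_all add: p trig algebra_simps)
  qed (simp add: p)
qed

lemma spline_piece_mult:
  assumes "spline_piece w p p'"
  shows "spline_piece w (\<lambda>x. k * p x) (\<lambda>x. k * p' x)"
  using assms
proof (cases rule: spline_piece_cases)
  case (cubic a b c d)
  show ?thesis
    unfolding \<open>w = 0\<close>
    by (rule spline_piece_cubicI[of _ "k * a" "k * b" "k * c" "k * d"])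
      (simp_all add: cubic algebra_simps)
next
  case (trig a b c d)
  show ?thesis
    by (rule spline_piece_trigI[of _ _ "k * a" "k * b" "k * c" "k * d"])
      (simp_all add: trig algebra_simps)
qed

lemma spline_piece_shift:
  assumes "spline_piece w p p'"
  shows "spline_piece w (\<lambda>x. p (x + t)) (\<lambda>x. p' (x + t))"
  using assms
proof (cases rule: spline_piece_cases)
  case (cubic a b c d)
  show ?thesis
    unfolding \<open>w = 0\<close>
    by (rule spline_piece_cubicI[of _ "a + b * t + c * t^2 + d * t^3"
          "b + 2 * c * t + 3 * d * t^2" "c + 3 * d * t" d])
      (simp_all add: cubic algebra_simps power2_eq_square power3_eq_cube)
next
  case (trig a b c d)
  show ?thesis
    by (rule spline_piece_trigI[of _ _ "a + b * t" b
          "c * cos (w * t) + d * sin (w * t)" "d * cos (w * t) - c * sin (w * t)"])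
      (simp_all add: trig algebra_simps cos_add sin_add)
qed

lemma spline_piece_reflect:
  assumes "spline_piece w p p'"
  shows "spline_piece w (\<lambda>x. p (- x)) (\<lambda>x. - p' (- x))"
  using assms
proof (cases rule: spline_piece_cases)
  case (cubic a b c d)
  show ?thesis
    unfolding \<open>w = 0\<close>
    by (rule spline_piece_cubicI[of _ a "- b" c "- d"]) (simp_all add: cubic algebra_simps)
next
  case (trig a b c d)
  show ?thesis
    by (rule spline_piece_trigI[of _ _ a "- b" c "- d"]) (simp_all add: trig algebra_simps)
qed

text \<open>This is where the parameters combine: dilating a piece of frequency \<open>h w\<close> by \<open>h\<close> leaves
  frequency \<open>w\<close>, so the generators at all resolutions have pieces in one and the same space.\<close>

lemma spline_piece_dilate:
  assumes "spline_piece (h * w) p p'" "h > 0"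
  shows "spline_piece w (\<lambda>x. p (x / h)) (\<lambda>x. p' (x / h) / h)"
  using assms(1)
proof (cases rule: spline_piece_cases)
  case (cubic a b c d)
  then have "w = 0"
    using assms by simp
  then show ?thesis
    using assms(2)
    by (auto intro!: spline_piece_cubicI[of _ a "b / h" "c / h^2" "d / h^3"]
        simp: cubic field_simps power2_eq_square power3_eq_cube)
next
  case (trig a b c d)
  then show ?thesis
    using assms(2)
    by (intro spline_piece_trigI[of _ _ a "b / h" c d]) (auto simp: trig field_simps)
qed

section \<open>Unisolvence of Hermite data\<close>

lemma sin_gt_mult_cos:
  fixes x :: real
  assumes "0 < x" "x \<le> pi / 2"
  shows "x * cos x < sin x"
proof -
  have "sin 0 - 0 * cos 0 < sin x - x * cos x"
  proof (rule DERIV_pos_imp_increasing_open[OF assms(1)])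
    fix y :: real
    assume y: "0 < y" "y < x"
    have "((\<lambda>y. sin y - y * cos y) has_real_derivative y * sin y) (at y)"
      by (auto intro!: derivative_eq_intros)
    moreover have "y * sin y > 0"
      using y assms by (intro mult_pos_pos sin_gt_zero) auto
    ultimately show "\<exists>D. ((\<lambda>y. sin y - y * cos y) has_real_derivative D) (at y) \<and> 0 < D"
      by blast
  qed (auto intro!: continuous_intros)
  then show ?thesis
    by simp
qed

lemma sin_cos_half:
  fixes w :: real
  shows "sin w = 2 * sin (w / 2) * cos (w / 2)" "cos w = 1 - 2 * (sin (w / 2))^2"
  using sin_double[of "w / 2"] cos_double_sin[of "w / 2"] by simp_all

lemma u_coef_factor: "u_coef w = - 2 * sin (w / 2) * s_coef w"
  unfolding u_coef_def s_coef_def sin_cos_half[of w] by (simp add: algebra_simps power2_eq_square)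

lemma coef_pos:
  assumes "0 < w" "w \<le> pi"
  shows "sin (w / 2) > 0" "s_coef w > 0" "t_coef w > 0"
proof -
  show sn: "sin (w / 2) > 0"
    using assms by (intro sin_gt_zero) auto
  show "s_coef w > 0"
    using sin_gt_mult_cos[of "w / 2"] assms by (simp add: s_coef_def)
  have "cos (w / 2) \<ge> 0"
    using assms by (intro cos_ge_zero) auto
  then show "t_coef w > 0"
    using sn assms by (simp add: t_coef_def add_pos_nonneg)
qed

text \<open>The conditions at 0 eliminate the coefficients of \<open>1\<close> and \<open>x\<close>. For \<open>w \<noteq> 0\<close> those at \<open>k\<close> then form a
  linear \<open>2 \<times> 2\<close> system with determinant \<open>- u_coef (k w)\<close>, which equals
  \<open>2 sin (k w / 2) s_coef (k w)\<close>. It vanishes nowhere on \<open>(0, pi]\<close>, as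
  \<open>x cos x < sin x\<close> for \<open>x\<close> in \<open>(0, pi / 2]\<close>; this is the role of the bound on the frequency.\<close>

lemma spline_piece_unisolvent:
  assumes "spline_piece w p p'" "k > 0" "0 \<le> k * w" "k * w \<le> pi"
    and z: "p 0 = 0" "p' 0 = 0" "p k = 0" "p' k = 0"
  shows "p x = 0"
  using assms(1)
proof (cases rule: spline_piece_cases)
  case (cubic a b c d)
  have ab: "a = 0" "b = 0"
    using z(1,2) cubic by auto
  have 1: "k^2 * (c + d * k) = 0"
    using z(3) cubic(2)[of k] ab by (simp add: algebra_simps power2_eq_square power3_eq_cube)
  have 2: "k * (2 * c + 3 * d * k) = 0"
    using z(4) cubic(3)[of k] ab by (simp add: algebra_simps power2_eq_square power3_eq_cube)
  from 1 2 have "c + d * k = 0" "2 * c + 3 * d * k = 0"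
    using assms(2) by auto
  then have "c = 0 \<and> d * k = 0"
    by linarith
  then show ?thesis
    using ab cubic assms(2) by simp
next
  case (trig a b c d)
  define v where "v = k * w"
  have v: "0 < v" "v \<le> pi"
    using assms(2-4) trig(1) by (auto simp: v_def order_less_le)
  have ab: "a = - c" "b = - d * w"
    using z(1,2) trig by auto
  have 1: "c * (cos v - 1) + d * (sin v - v) = 0"
    using z(3) trig(2)[of k] ab by (simp add: algebra_simps v_def)
  have "w * (- c * sin v + d * (cos v - 1)) = 0"
    using z(4) trig(3)[of k] ab by (simp add: algebra_simps v_def)
  then have 2: "- c * sin v + d * (cos v - 1) = 0"
    using trig(1) by simp
  have det: "u_coef v = - ((cos v - 1) * (cos v - 1) + sin v * (sin v - v))"
    unfolding u_coef_def using sin_cos_squared_add[of v]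
    by (simp add: algebra_simps power2_eq_square)
  have "u_coef v \<noteq> 0"
    using coef_pos[OF v] by (simp add: u_coef_factor)
  moreover have "u_coef v * c = 0" "u_coef v * d = 0"
    unfolding det using 1 2 by algebra+
  ultimately have "c = 0" "d = 0"
    by auto
  then show ?thesis
    using ab trig by simp
qed

section \<open>The generators as mirrored pieces\<close>

lemma g1_piece:
  assumes "0 \<le> w" "w \<le> pi"
  obtains p p' where "spline_piece w p p'" "\<And>x. g1 w x = p x * indicator {0..1} x"
    "p 0 = 1" "p' 0 = 0" "p 1 = 0" "p' 1 = 0"
proof (cases "w = 0")
  case True
  show ?thesis
  proof
    show "spline_piece w (\<lambda>x. (2 * x + 1) * (x - 1)^2) (\<lambda>x. 6 * x^2 - 6 * x)"
      unfolding True by (rule spline_piece_cubicI[of _ 1 0 "-3" 2])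
        (simp_all add: algebra_simps power2_eq_square power3_eq_cube)
  qed (auto simp: g1_def True)
next
  case False
  then have w: "0 < w"
    using assms by simp
  note pos = coef_pos[OF w assms(2)]
  let ?p = "\<lambda>x. 1 - sin (w / 2) / s_coef w + w * cos (w / 2) / s_coef w * x
            + sin (w / 2 - w * x) / s_coef w"
  let ?p' = "\<lambda>x. w * cos (w / 2) / s_coef w - w * cos (w / 2 - w * x) / s_coef w"
  have half: "w / 2 - w = - (w / 2)"
    by simp
  show ?thesis
  proof
    show "spline_piece w ?p ?p'"
      using False pos
      by (intro spline_piece_trigI[of _ _ "1 - sin (w / 2) / s_coef w" "w * cos (w / 2) / s_coef w"
            "sin (w / 2) / s_coef w" "- cos (w / 2) / s_coef w"])
        (simp_all add: sin_diff cos_diff diff_divide_distrib add_divide_distrib algebra_simps)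
    show "?p 1 = 0"
    proof -
      have "?p 1 = (s_coef w - 2 * sin (w / 2) + w * cos (w / 2)) / s_coef w"
        using pos unfolding mult_1_right half by (simp add: add_divide_distrib diff_divide_distrib)
      then show ?thesis
        by (simp add: s_coef_def)
    qed
    show "?p' 1 = 0"
      unfolding mult_1_right half by simp
  qed (auto simp: g1_def False)
qed

text \<open>In half-angle terms the closed formula collapses: with \<open>S\<close>, \<open>C\<close> the sine and cosine of \<open>w / 2\<close>, a
  factor \<open>2 S t\<close> cancels from the coefficient of \<open>sin (w x)\<close>, which becomes \<open>(S - w C) / (w s)\<close>, and
  a factor \<open>t\<close> from that of \<open>cos (w x)\<close>, which becomes the negative of the constant term. In this
  form the four Hermite conditions are polynomial identities modulo \<open>S\<^sup>2 + C\<^sup>2 = 1\<close>.\<close>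

lemma g2_piece:
  assumes "0 \<le> w" "w \<le> pi"
  obtains p p' where "spline_piece w p p'" "\<And>x. g2 w x = p x * indicator {0..1} x"
    "p 0 = 0" "p' 0 = 1" "p 1 = 0" "p' 1 = 0"
proof (cases "w = 0")
  case True
  show ?thesis
  proof
    show "spline_piece w (\<lambda>x. x * (x - 1)^2) (\<lambda>x. 3 * x^2 - 4 * x + 1)"
      unfolding True by (rule spline_piece_cubicI[of _ 0 1 "-2" 1])
        (simp_all add: algebra_simps power2_eq_square power3_eq_cube)
  qed (auto simp: g2_def True)
next
  case False
  then have w: "0 < w"
    using assms by simp
  define S C s t where "S = sin (w / 2)" and "C = cos (w / 2)" and "s = s_coef w" and "t = t_coef w"
  have pos: "S > 0" "s > 0" "t > 0"
    using coef_pos[OF w assms(2)] by (auto simp: S_def s_def t_def)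
  have s: "s = 2 * S - w * C" and t: "t = 2 * S + w * C"
    by (simp_all add: s_def s_coef_def t_def t_coef_def S_def C_def)
  have C2: "C^2 = 1 - S^2"
    by (simp add: S_def C_def cos_squared_eq)
  have sw: "sin w = 2 * S * C" and cw: "cos w = 1 - 2 * S^2"
    using sin_cos_half[of w] by (simp_all add: S_def C_def)
  define A where "A = - (2 * S * C - w * (1 - 2 * S^2)) / (2 * w * S * s)"
  define d where "d = (S - w * C) / (w * s)"
  let ?p = "\<lambda>x. A + S / s * x - A * cos (w * x) + d * sin (w * x)"
  let ?p' = "\<lambda>x. S / s + A * w * sin (w * x) + d * w * cos (w * x)"
  have u: "u_coef w = - 2 * S * s"
    by (simp add: u_coef_factor S_def s_def)
  have v: "v_coef w = 4 * S * C + 2 * w * S^2"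
    by (simp add: v_coef_def sw cw)
  have eA: "(sin w - w * cos w) / (w * u_coef w) = A"
    using w pos unfolding A_def u sw cw by (simp add: field_simps)
  have "w^2 * C * (1 - 2 * S^2) - S * (4 * S * C + 2 * w * S^2)
      = - (2 * S * C - w * (1 - 2 * S^2)) * t"
    unfolding t using C2 by algebra
  then have ec: "(w^2 * C * cos w - S * v_coef w) / (2 * w * S * s * t) = A"
    using pos unfolding A_def v cw by simp
  have "- (w^2 * C * sin w + S * u_coef w) = (S - w * C) * (2 * S * t)"
    unfolding s t u sw by algebra
  moreover have "2 * w * S * s * t = w * s * (2 * S * t)"
    by simp
  ultimately have "- (w^2 * C * sin w + S * u_coef w) / (2 * w * S * s * t)
      = (S - w * C) * (2 * S * t) / (w * s * (2 * S * t))"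
    by (simp only:)
  also have "\<dots> = d"
    unfolding d_def by (rule mult_divide_mult_cancel_right) (use pos in auto)
  finally have ed: "- (w^2 * C * sin w + S * u_coef w) / (2 * w * S * s * t) = d" .
  have g2: "g2 w x = ?p x * indicator {0..1} x" for x
  proof -
    have "(w^2 * C * cos (w * (1 - x)) + S * (sin (w * x) * u_coef w - cos (w * x) * v_coef w))
              / (2 * w * S * s * t)
        = (w^2 * C * cos w - S * v_coef w) / (2 * w * S * s * t) * cos (w * x)
          - (- (w^2 * C * sin w + S * u_coef w) / (2 * w * S * s * t)) * sin (w * x)"
      unfolding right_diff_distrib cos_diff using w pos by (simp add: field_simps)
    then show ?thesis
      unfolding g2_def eA ec ed using False by (simp add: S_def C_def s_def t_def)
  qed
  show ?thesis
  proof (rule that[OF _ g2])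
    show "spline_piece w ?p ?p'"
      using False by (intro spline_piece_trigI[of _ _ A "S / s" "- A" d]) auto
    show "?p' 0 = 1"
    proof -
      have "?p' 0 = (2 * S - w * C) / s"
        using pos w by (simp add: d_def field_simps)
      then show ?thesis
        unfolding s[symmetric] using pos by simp
    qed
    have "?p 1 = A * (2 * S^2) + S / s + d * (2 * S * C)"
      by (simp add: sw cw algebra_simps)
    also have "\<dots> = (- S * (2 * S * C - w * (1 - 2 * S^2)) + w * S + 2 * S * C * (S - w * C)) / (w * s)"
      using pos w by (simp add: A_def d_def field_simps power2_eq_square)
    also have "- S * (2 * S * C - w * (1 - 2 * S^2)) + w * S + 2 * S * C * (S - w * C) = 0"
      using C2 by algebra
    finally show "?p 1 = 0"
      by simp
    have "?p' 1 = (S - C * (2 * S * C - w * (1 - 2 * S^2)) + (S - w * C) * (1 - 2 * S^2)) / s"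
      unfolding mult_1_right sw cw
      using pos w by (simp add: A_def d_def field_simps power2_eq_square)
    also have "S - C * (2 * S * C - w * (1 - 2 * S^2)) + (S - w * C) * (1 - 2 * S^2) = 0"
      using C2 by algebra
    finally show "?p' 1 = 0"
      by simp
  qed auto
qed


lemma has_derivative_glue:
  fixes p q :: "real \<Rightarrow> real"
  assumes p: "\<And>x. (p has_real_derivative p' x) (at x)"
    and q: "\<And>x. (q has_real_derivative q' x) (at x)"
    and "p c = q c" "p' c = q' c"
  shows "((\<lambda>x. if x \<le> c then p x else q x) has_real_derivative
           (if x \<le> c then p' x else q' x)) (at x)"
proof -
  have "((\<lambda>x. if x \<in> {..c} then p x else q x) has_vector_derivative
           (if x \<in> {..c} then p' x else q' x)) (at x within UNIV)"
    using assms
    by (intro has_vector_derivative_If_within_closures[where T = "{c<..}"])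
      (auto simp: has_real_derivative_iff_has_vector_derivative
        intro: has_vector_derivative_at_within)
  then show ?thesis
    by (simp add: has_real_derivative_iff_has_vector_derivative)
qed

text \<open>Extension of \<open>p\<close> from \<open>[0, h]\<close> to an even (\<open>\<sigma> = 1\<close>) or odd (\<open>\<sigma> = - 1\<close>) function supported in
  \<open>[- h, h]\<close>. With a sign parameter the derivative is of the same form, with \<open>- \<sigma>\<close>, and both
  generators are treated at once.\<close>

definition mirrored :: "real \<Rightarrow> real \<Rightarrow> (real \<Rightarrow> real) \<Rightarrow> real \<Rightarrow> real" where
  "mirrored \<sigma> h p x =
     (if x \<le> - h then 0 else if x \<le> 0 then \<sigma> * p (- x) else if x \<le> h then p x else 0)"

text \<open>Values and slopes of adjacent pieces agree at the knots: at \<open>\<plusminus> h\<close> by the zero conditions there, and at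
  0 because the parity of \<open>\<sigma>\<close> forces the value or the slope of \<open>p\<close> at 0 to vanish.\<close>

lemma mirrored_has_derivative:
  assumes p: "spline_piece w p p'" and h: "h > 0"
    and z: "p h = 0" "p' h = 0" "\<sigma> * p 0 = p 0" "- \<sigma> * p' 0 = p' 0"
  shows "(mirrored \<sigma> h p has_real_derivative mirrored (- \<sigma>) h p' x) (at x)"
proof -
  define f1 where "f1 x = (if x \<le> h then p x else 0)" for x
  define f1' where "f1' x = (if x \<le> h then p' x else 0)" for x
  define f2 where "f2 x = (if x \<le> 0 then \<sigma> * p (- x) else f1 x)" for x
  define f2' where "f2' x = (if x \<le> 0 then \<sigma> * - p' (- x) else f1' x)" for x
  have d1: "(f1 has_real_derivative f1' x) (at x)" for x
    unfolding f1_def [abs_def] f1'_def using z spline_piece_has_derivative[OF p]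
    by (intro has_derivative_glue) auto
  have "f1 0 = p 0" "f1' 0 = p' 0"
    using h by (auto simp: f1_def f1'_def)
  then have d2: "(f2 has_real_derivative f2' x) (at x)" for x
    unfolding f2_def [abs_def] f2'_def using z
    by (intro has_derivative_glue d1
        spline_piece_has_derivative[OF spline_piece_mult[OF spline_piece_reflect[OF p]]]) auto
  have "((\<lambda>x. if x \<le> - h then 0 else f2 x) has_real_derivative
      (if x \<le> - h then 0 else f2' x)) (at x)"
    using z h by (intro has_derivative_glue d2) (auto simp: f2_def f2'_def)
  moreover have "mirrored \<sigma> h p = (\<lambda>x. if x \<le> - h then 0 else f2 x)"
    "mirrored (- \<sigma>) h p' x = (if x \<le> - h then 0 else f2' x)"
    by (auto simp: mirrored_def f1_def f2_def f1'_def f2'_def)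
  ultimately show ?thesis
    by simp
qed

lemma mirrored_eq_0: "p h = 0 \<Longrightarrow> h > 0 \<Longrightarrow> h \<le> \<bar>x\<bar> \<Longrightarrow> mirrored \<sigma> h p x = 0"
  by (auto simp: mirrored_def abs_if split: if_splits)

lemma mirrored_right:
  "\<sigma> * p 0 = p 0 \<Longrightarrow> h > 0 \<Longrightarrow> 0 \<le> x \<Longrightarrow> x \<le> h \<Longrightarrow> mirrored \<sigma> h p x = p x"
  by (cases "x = 0") (auto simp: mirrored_def)

lemma mirrored_left: "p h = 0 \<Longrightarrow> - h \<le> x \<Longrightarrow> x \<le> 0 \<Longrightarrow> mirrored \<sigma> h p x = \<sigma> * p (- x)"
  by (auto simp: mirrored_def)

section \<open>Hermite interpolation on a grid\<close>

definition C1_spline :: "real \<Rightarrow> real \<Rightarrow> (real \<Rightarrow> real) \<Rightarrow> (real \<Rightarrow> real) \<Rightarrow> bool" where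
  "C1_spline w k f f' \<longleftrightarrow> (\<forall>x. (f has_real_derivative f' x) (at x)) \<and>
     (\<forall>j::int. \<exists>q q'. spline_piece w q q' \<and>
        (\<forall>x. of_int j * k \<le> x \<and> x \<le> (of_int j + 1) * k \<longrightarrow> f x = q x \<and> f' x = q' x))"

text \<open>The knots \<open>- h\<close>, 0 and \<open>h\<close> belong to the grid of step \<open>h / m\<close>, so every cell of that grid lies in
  one of the four pieces.\<close>

lemma C1_spline_mirrored:
  assumes p: "spline_piece w p p'" and h: "h > 0" and m: "m > (0::nat)"
    and z: "p h = 0" "p' h = 0" "\<sigma> * p 0 = p 0" "- \<sigma> * p' 0 = p' 0"
  shows "C1_spline w (h / m) (mirrored \<sigma> h p) (mirrored (- \<sigma>) h p')"
proof -
  define k where "k = h / m"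
  have k: "k > 0" "h = m * k"
    using h m by (auto simp: k_def)
  have "\<exists>q q'. spline_piece w q q' \<and> (\<forall>x. of_int j * k \<le> x \<and> x \<le> (of_int j + 1) * k
      \<longrightarrow> mirrored \<sigma> h p x = q x \<and> mirrored (- \<sigma>) h p' x = q' x)" for j :: int
  proof -
    have cell: "of_int a * k \<le> x" if "of_int j * k \<le> x" "a \<le> j" for a :: int and x
    proof -
      have "of_int a * k \<le> of_int j * k"
        using that k by (intro mult_right_mono) auto
      then show ?thesis
        using that by simp
    qed
    have cell': "x \<le> of_int a * k" if "x \<le> (of_int j + 1) * k" "j < a" for a :: int and x
    proof -
      have "of_int (j + 1) \<le> (of_int a :: real)"
        using that(2) unfolding of_int_le_iff by simp
      then have "(of_int j + 1) * k \<le> of_int a * k"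
        using k by (intro mult_right_mono) auto
      then show ?thesis
        using that by simp
    qed
    consider "j < - int m" | "- int m \<le> j" "j < 0" | "0 \<le> j" "j < int m" | "int m \<le> j"
      by linarith
    then show ?thesis
    proof cases
      case 1
      have "mirrored \<sigma> h p x = 0 \<and> mirrored (- \<sigma>) h p' x = 0" if "x \<le> (of_int j + 1) * k" for x
        using cell'[OF that 1] k h z by (auto intro!: mirrored_eq_0)
      then show ?thesis
        using spline_piece_0[of w] by blast
    next
      case 2
      have "mirrored \<sigma> h p x = \<sigma> * p (- x) \<and> mirrored (- \<sigma>) h p' x = \<sigma> * - p' (- x)"
        if "of_int j * k \<le> x" "x \<le> (of_int j + 1) * k" for x
        using cell[OF that(1) 2(1)] cell'[OF that(2) 2(2)] k z by (auto simp: mirrored_left)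
      then show ?thesis
        using spline_piece_mult[OF spline_piece_reflect[OF p], of \<sigma>] by blast
    next
      case 3
      have "mirrored \<sigma> h p x = p x \<and> mirrored (- \<sigma>) h p' x = p' x"
        if "of_int j * k \<le> x" "x \<le> (of_int j + 1) * k" for x
        using cell[OF that(1) 3(1)] cell'[OF that(2) 3(2)] h k z by (auto simp: mirrored_right)
      then show ?thesis
        using p by blast
    next
      case 4
      have "mirrored \<sigma> h p x = 0 \<and> mirrored (- \<sigma>) h p' x = 0" if "of_int j * k \<le> x" for x
        using cell[OF that 4] k h z by (auto intro!: mirrored_eq_0)
      then show ?thesis
        using spline_piece_0[of w] by blast
    qed
  qed
  then show ?thesis
    unfolding C1_spline_def k_def[symmetric] using mirrored_has_derivative[OF p h z] by blast
qed

lemma phi1_scaled_mirrored: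
  assumes "h > 0" "0 \<le> h * w" "h * w \<le> pi"
  obtains p p' where "spline_piece w p p'" "p 0 = 1" "p' 0 = 0" "p h = 0" "p' h = 0"
    "phi1_scaled w h = mirrored 1 h p"
proof -
  obtain p p' where p: "spline_piece (h * w) p p'" "\<And>x. g1 (h * w) x = p x * indicator {0..1} x"
    "p 0 = 1" "p' 0 = 0" "p 1 = 0" "p' 1 = 0"
    using g1_piece[OF assms(2,3)] by metis
  have "phi1_scaled w h x = mirrored 1 h (\<lambda>x. p (x / h)) x" for x
    using assms(1) p(3,5)
    by (auto simp: phi1_scaled_def phi1_def p(2) mirrored_def indicator_def field_simps)
  then show ?thesis
    using p assms(1) by (intro that[OF spline_piece_dilate[OF p(1) assms(1)]]) auto
qed

lemma phi2_scaled_mirrored: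
  assumes "h > 0" "0 \<le> h * w" "h * w \<le> pi"
  obtains p p' where "spline_piece w p p'" "p 0 = 0" "p' 0 = 1" "p h = 0" "p' h = 0"
    "phi2_scaled w h = mirrored (- 1) h p"
proof -
  obtain p p' where p: "spline_piece (h * w) p p'" "\<And>x. g2 (h * w) x = p x * indicator {0..1} x"
    "p 0 = 0" "p' 0 = 1" "p 1 = 0" "p' 1 = 0"
    using g2_piece[OF assms(2,3)] by metis
  have "phi2_scaled w h x = mirrored (- 1) h (\<lambda>x. h * p (x / h)) x" for x
    using assms(1) p(3,5)
    by (auto simp: phi2_scaled_def phi2_def p(2) mirrored_def indicator_def field_simps)
  then show ?thesis
    using p assms(1)
    by (intro that[OF spline_piece_mult[OF spline_piece_dilate[OF p(1) assms(1)]]]) auto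
qed

text \<open>On \<open>[0, k]\<close> the two generators and their translates by \<open>k\<close> are the basis dual to the values and slopes
  at 0 and \<open>k\<close>. The difference of the two sides is a piece with vanishing Hermite data, hence zero.\<close>

lemma hermite_interpolation:
  assumes q: "spline_piece w q q'" and k: "k > 0" "0 \<le> k * w" "k * w \<le> pi"
    and x: "0 \<le> x" "x \<le> k"
  shows "q x = q 0 * phi1_scaled w k x + q' 0 * phi2_scaled w k x
             + q k * phi1_scaled w k (x - k) + q' k * phi2_scaled w k (x - k)"
proof -
  obtain p1 p1' where p1: "spline_piece w p1 p1'" "p1 0 = 1" "p1' 0 = 0" "p1 k = 0" "p1' k = 0"
    "phi1_scaled w k = mirrored 1 k p1"
    using phi1_scaled_mirrored[OF k] by metis
  obtain p2 p2' where p2: "spline_piece w p2 p2'" "p2 0 = 0" "p2' 0 = 1" "p2 k = 0" "p2' k = 0"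
    "phi2_scaled w k = mirrored (- 1) k p2"
    using phi2_scaled_mirrored[OF k] by metis
  note flip = spline_piece_shift[OF spline_piece_reflect, of _ _ _ "- k"]
  define r where "r x = q x + (- q 0 * p1 x + (- q' 0 * p2 x
      + (- q k * p1 (- (x + - k)) + q' k * p2 (- (x + - k)))))" for x
  have "spline_piece w r (\<lambda>x. q' x + (- q 0 * p1' x + (- q' 0 * p2' x
      + (- q k * - p1' (- (x + - k)) + q' k * - p2' (- (x + - k))))))"
    unfolding r_def [abs_def]
    by (intro spline_piece_add spline_piece_mult flip q p1(1) p2(1))
  then have "r x = 0"
    by (rule spline_piece_unisolvent[OF _ k]) (use p1 p2 in \<open>auto simp: r_def\<close>)
  moreover have "phi1_scaled w k x = p1 x" "phi2_scaled w k x = p2 x"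
    "phi1_scaled w k (x - k) = p1 (k - x)" "phi2_scaled w k (x - k) = - p2 (k - x)"
    using x k p1(2,4) p2(2,4) unfolding p1(6) p2(6) by (auto simp: mirrored_right mirrored_left)
  ultimately show ?thesis
    by (simp add: r_def)
qed

lemma C1_spline_eq_on_cell:
  assumes f: "C1_spline w k f f'" and k: "k > 0" "0 \<le> k * w" "k * w \<le> pi"
    and x: "of_int j * k \<le> x" "x \<le> (of_int j + 1) * k"
  shows "f x = (\<Sum>l\<in>{j, j + 1}. f (of_int l * k) * phi1_scaled w k (x - of_int l * k)
                               + f' (of_int l * k) * phi2_scaled w k (x - of_int l * k))"
proof -
  define y where "y = of_int j * k"
  have yk: "(of_int j + 1) * k = y + k"
    by (simp add: y_def algebra_simps)
  have yk': "of_int (j + 1) * k = y + k"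
    by (simp add: y_def algebra_simps)
  have "\<exists>q q'. spline_piece w q q' \<and> (\<forall>x. of_int j * k \<le> x \<and> x \<le> (of_int j + 1) * k
      \<longrightarrow> f x = q x \<and> f' x = q' x)"
    using f unfolding C1_spline_def by blast
  then obtain q q' where q: "spline_piece w q q'"
    "\<And>x. y \<le> x \<Longrightarrow> x \<le> y + k \<Longrightarrow> f x = q x \<and> f' x = q' x"
    unfolding yk y_def[symmetric] by blast
  have "q (x - y + y) = q (0 + y) * phi1_scaled w k (x - y) + q' (0 + y) * phi2_scaled w k (x - y)
      + q (k + y) * phi1_scaled w k (x - y - k) + q' (k + y) * phi2_scaled w k (x - y - k)"
    using x unfolding yk y_def[symmetric]
    by (intro hermite_interpolation[OF spline_piece_shift[OF q(1)] k]) auto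
  then show ?thesis
    using q(2)[of x] q(2)[of y] q(2)[of "y + k"] x k
    unfolding yk by (simp add: yk' y_def[symmetric] diff_diff_eq add.commute[of k] del: of_int_add)
qed


section \<open>The refinement mask\<close>

lemma phi_scaled_nth [simp]:
  "phi_scaled w h x $ 1 = phi1_scaled w h x" "phi_scaled w h x $ 2 = phi2_scaled w h x"
  by (simp_all add: phi_scaled_def)

lemma phi_scaled_C1_spline:
  assumes h: "h > 0" "0 \<le> h * w" "h * w \<le> pi" and m: "m > (0::nat)"
  obtains D where "C1_spline w (h / m) (\<lambda>x. phi_scaled w h x $ i) D"
    "\<And>x. h \<le> \<bar>x\<bar> \<Longrightarrow> phi_scaled w h x $ i = 0 \<and> D x = 0"
proof (cases "i = 1")
  case True
  obtain p p' where p: "spline_piece w p p'" "p 0 = 1" "p' 0 = 0" "p h = 0" "p' h = 0"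
    "phi1_scaled w h = mirrored 1 h p"
    using phi1_scaled_mirrored[OF h] by metis
  show ?thesis
    by (rule that[of "mirrored (- 1) h p'"])
      (use True p h(1) C1_spline_mirrored[OF p(1) h(1) m p(4,5), of 1] mirrored_eq_0 in auto)
next
  case False
  then have i: "i = 2"
    using exhaust_2 by blast
  obtain p p' where p: "spline_piece w p p'" "p 0 = 0" "p' 0 = 1" "p h = 0" "p' h = 0"
    "phi2_scaled w h = mirrored (- 1) h p"
    using phi2_scaled_mirrored[OF h] by metis
  show ?thesis
    by (rule that[of "mirrored 1 h p'"])
      (use i p h(1) C1_spline_mirrored[OF p(1) h(1) m p(4,5), of "- 1"] mirrored_eq_0 in auto)
qed

lemma phi_scaled_eq_0:
  assumes "h > 0" "0 \<le> h * w" "h * w \<le> pi" "h \<le> \<bar>x\<bar>"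
  shows "phi_scaled w h x = 0"
proof -
  have "phi_scaled w h x $ i = 0" for i
    by (rule phi_scaled_C1_spline[OF assms(1-3) zero_less_one]) (use assms in auto)
  then show ?thesis
    by (simp add: vec_eq_iff)
qed

lemma phi_scaled_has_derivative:
  assumes "h > 0" "0 \<le> h * w" "h * w \<le> pi"
  shows "((\<lambda>x. phi_scaled w h x $ i) has_real_derivative deriv (\<lambda>x. phi_scaled w h x $ i) x) (at x)"
proof -
  obtain D where "C1_spline w (h / (1::nat)) (\<lambda>x. phi_scaled w h x $ i) D"
    using phi_scaled_C1_spline[OF assms zero_less_one] by metis
  then show ?thesis
    unfolding C1_spline_def using DERIV_imp_deriv by metis
qed

text \<open>Row \<open>i\<close> of the mask lists the Hermite data of the coarse generator \<open>i\<close> at a fine grid point, in the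
  order in which \<open>phi_scaled\<close> lists the functions dual to them.\<close>

lemma refinement_mask_nth:
  "refinement_mask w h m l $ i $ 1 = phi_scaled w h (of_int l * (h / m)) $ i"
  "refinement_mask w h m l $ i $ 2 = deriv (\<lambda>x. phi_scaled w h x $ i) (of_int l * (h / m))"
  using exhaust_2[of i] by (auto simp: refinement_mask_def)

lemma refinement_mask_eq_0:
  assumes h: "h > 0" "0 \<le> h * w" "h * w \<le> pi" and m: "m > 0" and l: "int m \<le> \<bar>l\<bar>"
  shows "refinement_mask w h m l $ i $ j = 0"
proof -
  obtain D where D: "C1_spline w (h / m) (\<lambda>x. phi_scaled w h x $ i) D"
    "\<And>x. h \<le> \<bar>x\<bar> \<Longrightarrow> phi_scaled w h x $ i = 0 \<and> D x = 0"
    using phi_scaled_C1_spline[OF h m] by metis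
  have "deriv (\<lambda>x. phi_scaled w h x $ i) x = D x" for x
    using D(1) DERIV_imp_deriv unfolding C1_spline_def by blast
  moreover have "h \<le> \<bar>of_int l * (h / m)\<bar>"
  proof -
    have "real m * (h / m) \<le> \<bar>of_int l\<bar> * (h / m)"
      using h(1) l by (intro mult_right_mono) (auto simp: of_nat_le_iff)
    then show ?thesis
      using h(1) m by (simp add: abs_mult)
  qed
  ultimately show ?thesis
    using D(2) exhaust_2[of j] by (auto simp: refinement_mask_nth)
qed

lemma refined_step:
  assumes "h > 0" "0 \<le> h * w" "h * w \<le> pi" "m > (0::nat)"
  shows "h / m > 0" "0 \<le> h / m * w" "h / m * w \<le> pi"
proof -
  show "h / m > 0" "0 \<le> h / m * w"
    using assms by auto
  have "h * w / m \<le> h * w / 1"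
    using assms by (intro divide_left_mono) auto
  then show "h / m * w \<le> pi"
    using assms(3) by simp
qed

text \<open>Translation by \<open>n h\<close> moves the fine grid to itself, since \<open>h\<close> is \<open>m\<close> fine steps; the mask index
  shifts by \<open>m n\<close>. Both the two-scale relation (\<open>n = 0\<close>) and the inclusion of the spline spaces
  come from this finite identity on one fine cell.\<close>

lemma phi_scaled_refinement:
  assumes h: "h > 0" "0 \<le> h * w" "h * w \<le> pi" and m: "m > 0"
    and x: "of_int j * (h / m) \<le> x" "x \<le> (of_int j + 1) * (h / m)"
  shows "phi_scaled w h (x - of_int n * h) $ i
    = (\<Sum>l\<in>{j, j + 1}. \<Sum>c\<in>UNIV. refinement_mask w h m (l - int m * n) $ i $ c
                                 * phi_scaled w (h / m) (x - of_int l * (h / m)) $ c)"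
proof -
  define k where "k = h / m"
  have hk: "h = m * k"
    using m by (simp add: k_def)
  note k = refined_step[OF h m, folded k_def]
  let ?f = "\<lambda>x. phi_scaled w h x $ i"
  obtain D where "C1_spline w k ?f D"
    unfolding k_def using phi_scaled_C1_spline[OF h m] by metis
  then have f: "C1_spline w k ?f (deriv ?f)"
    unfolding C1_spline_def using DERIV_imp_deriv by metis
  define j' where "j' = j - int m * n"
  have "of_int j' * k \<le> x - of_int n * h" "x - of_int n * h \<le> (of_int j' + 1) * k"
    using x unfolding k_def[symmetric] by (auto simp: j'_def hk algebra_simps)
  note C1_spline_eq_on_cell[OF f k this]
  also have "(\<Sum>l\<in>{j', j' + 1}. ?f (of_int l * k) * phi1_scaled w k (x - of_int n * h - of_int l * k)
        + deriv ?f (of_int l * k) * phi2_scaled w k (x - of_int n * h - of_int l * k))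
     = (\<Sum>l\<in>{j, j + 1}. ?f (of_int (l - int m * n) * k) * phi1_scaled w k (x - of_int l * k)
        + deriv ?f (of_int (l - int m * n) * k) * phi2_scaled w k (x - of_int l * k))"
    by (rule sum.reindex_bij_witness[of _ "\<lambda>l. l - int m * n" "\<lambda>l. l + int m * n"])
      (auto simp: j'_def hk algebra_simps)
  finally show ?thesis
    by (simp add: sum_2 refinement_mask_nth k_def)
qed

section \<open>Series with finitely many terms at each point\<close>

lemma has_sum_finite_support:
  assumes "finite S" "\<And>n. n \<notin> S \<Longrightarrow> f n = 0"
  shows "(f has_sum sum f S) UNIV"
  using has_sum_cong_neutral[of UNIV S f f "sum f S"] assms by auto

lemma dist_outside_cell:
  fixes k x :: real
  assumes "k > 0" "n \<notin> {\<lfloor>x / k\<rfloor>, \<lfloor>x / k\<rfloor> + 1}"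
  shows "k \<le> \<bar>x - of_int n * k\<bar>"
proof -
  have "n \<le> \<lfloor>x / k\<rfloor> - 1 \<or> n \<ge> \<lfloor>x / k\<rfloor> + 2"
    using assms(2) by auto
  then have "1 \<le> \<bar>x / k - of_int n\<bar>"
    by linarith
  then have "k * 1 \<le> k * \<bar>x / k - of_int n\<bar>"
    using assms(1) by (intro mult_left_mono) auto
  also have "\<dots> = \<bar>k * (x / k - of_int n)\<bar>"
    using assms(1) by (simp add: abs_mult)
  also have "k * (x / k - of_int n) = x - of_int n * k"
    using assms(1) by (simp add: algebra_simps)
  finally show ?thesis
    by simp
qed

lemma floor_cell:
  fixes k x :: real
  assumes "k > 0"
  shows "of_int \<lfloor>x / k\<rfloor> * k \<le> x" "x \<le> (of_int \<lfloor>x / k\<rfloor> + 1) * k"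
proof -
  show "of_int \<lfloor>x / k\<rfloor> * k \<le> x"
    using of_int_floor_le[of "x / k"] by (simp only: pos_le_divide_eq[OF assms])
  have "x / k \<le> of_int \<lfloor>x / k\<rfloor> + 1"
    by linarith
  then show "x \<le> (of_int \<lfloor>x / k\<rfloor> + 1) * k"
    by (simp only: pos_divide_le_eq[OF assms])
qed

section \<open>Square-summable coefficient sequences\<close>

definition square_summable :: "(int \<Rightarrow> 'b::real_normed_vector) \<Rightarrow> bool" where
  "square_summable f \<longleftrightarrow> (\<lambda>n. (norm (f n))^2) summable_on UNIV"

lemma square_summable_scaleR:
  "square_summable f \<Longrightarrow> square_summable (\<lambda>n. c *\<^sub>R f n)"
  by (simp add: square_summable_def power_mult_distrib summable_on_cmult_right)

lemma square_summable_add: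
  assumes "square_summable f" "square_summable g"
  shows "square_summable (\<lambda>n. f n + g n)"
proof -
  let ?g = "\<lambda>n. 2 * (norm (f n))^2 + 2 * (norm (g n))^2"
  have "?g summable_on UNIV"
    using assms unfolding square_summable_def
    by (intro summable_on_add summable_on_cmult_right)
  then have "(\<lambda>n. norm (?g n)) summable_on UNIV"
    by (rule summable_on_iff_abs_summable_on_real[THEN iffD1])
  then have "(\<lambda>n. norm ((norm (f n + g n))^2)) summable_on UNIV"
  proof (rule Infinite_Sum.abs_summable_on_comparison_test)
    fix n
    have "(norm (f n + g n))^2 \<le> (norm (f n) + norm (g n))^2"
      by (intro power_mono norm_triangle_ineq) auto
    also have "\<dots> \<le> ?g n"
      using sum_squares_ge_zero[of "norm (f n) - norm (g n)" 0]
      by (simp add: power2_eq_square algebra_simps)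
    finally show "norm ((norm (f n + g n))^2) \<le> norm (?g n)"
      by simp
  qed
  then show ?thesis
    by (simp add: square_summable_def)
qed

lemma square_summable_shift:
  assumes "square_summable f"
  shows "square_summable (\<lambda>n. f (n + c))"
proof -
  have "bij (\<lambda>n. n + c)"
    by (rule bij_betwI[of _ _ _ "\<lambda>n. n - c"]) auto
  from summable_on_reindex_bij_betw[OF this, of "\<lambda>n. (norm (f n))^2"] show ?thesis
    using assms unfolding square_summable_def by simp
qed

lemma square_summable_vec2_iff:
  fixes f :: "int \<Rightarrow> 'b::real_normed_vector ^ 2"
  shows "square_summable f \<longleftrightarrow> (\<forall>i. square_summable (\<lambda>n. f n $ i))"
proof
  assume "square_summable f"
  then have f: "(\<lambda>n. norm ((norm (f n))^2)) summable_on UNIV"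
    by (simp add: square_summable_def)
  have "(\<lambda>n. norm ((norm (f n $ i))^2)) summable_on UNIV" for i
    by (rule Infinite_Sum.abs_summable_on_comparison_test[OF f]) (simp add: Finite_Cartesian_Product.norm_nth_le power_mono)
  then show "\<forall>i. square_summable (\<lambda>n. f n $ i)"
    by (simp add: square_summable_def)
next
  assume f: "\<forall>i. square_summable (\<lambda>n. f n $ i)"
  have "(norm (f n))^2 = (norm (f n $ 1))^2 + (norm (f n $ 2))^2" for n
    by (simp add: norm_vec_def L2_set_def sum_2)
  then show "square_summable f"
    using f unfolding square_summable_def by (auto intro: summable_on_add)
qed

text \<open>Coefficients at the fine resolution depend on the residue of their index modulo \<open>m\<close>; along each
  residue class they are a fixed linear combination of two shifts of the coarse coefficients.\<close>

lemma square_summable_residues: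
  assumes m: "m > 0" and f: "\<And>r. 0 \<le> r \<Longrightarrow> r < m \<Longrightarrow> square_summable (\<lambda>q. f (m * q + r))"
  shows "square_summable f"
proof -
  let ?B = "\<lambda>r. range (\<lambda>q. m * q + r)"
  have "(\<lambda>n. (norm (f n))^2) summable_on (\<Union>r\<in>{0..<m}. ?B r)"
  proof (rule summable_on_finite_union_disjoint)
    fix r assume r: "r \<in> {0..<m}"
    have "inj (\<lambda>q. m * q + r)"
      using m by (auto intro: injI)
    then show "(\<lambda>n. (norm (f n))^2) summable_on ?B r"
      using f[of r] r by (simp add: summable_on_reindex square_summable_def o_def)
  next
    fix r r' assume r: "r \<in> {0..<m}" "r' \<in> {0..<m}" "r \<noteq> r'"
    have res: "n mod m = r" if "n \<in> ?B r" "r \<in> {0..<m}" for n r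
    proof -
      obtain q where "n = m * q + r"
        using \<open>n \<in> ?B r\<close> by blast
      then have "n mod m = r mod m"
        by (simp only: mod_mult_self4)
      then show ?thesis
        using that by (simp add: mod_pos_pos_trivial)
    qed
    show "?B r \<inter> ?B r' = {}"
    proof (rule equals0I)
      fix n assume "n \<in> ?B r \<inter> ?B r'"
      then have "n mod m = r" "n mod m = r'"
        using res r(1,2) by (simp_all only: Int_iff)
      then show False
        using r(3) by simp
    qed
  qed simp
  moreover have "(\<Union>r\<in>{0..<m}. ?B r) = UNIV"
  proof -
    have "n \<in> ?B (n mod m)" for n
      by (rule range_eqI[of _ _ "n div m"]) simp
    moreover have "n mod m \<in> {0..<m}" for n
      using m by simp
    ultimately have "n \<in> (\<Union>r\<in>{0..<m}. ?B r)" for n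
      by (rule UN_I[rotated])
    then show ?thesis
      by (rule UNIV_eq_I[symmetric])
  qed
  ultimately show ?thesis
    by (simp only: square_summable_def)
qed

section \<open>Nested spline spaces and the two-scale relation\<close>

text \<open>The fine coefficients of a coarse spline are its values and slopes at the fine grid points. At the
  index \<open>l\<close> only the translates by \<open>n h\<close> with \<open>\<bar>l - m n\<bar> < m\<close> contribute, that is, \<open>n = l div m\<close> and, unless
  \<open>m\<close> divides \<open>l\<close>, also \<open>n = l div m + 1\<close>. At a given point all sums are therefore finite and may be interchanged.\<close>

lemma hermite_spline_space_refine:
  assumes h: "h > 0" "0 \<le> h * w" "h * w \<le> pi" and m: "m > (0::nat)"
  shows "(hermite_spline_space w h :: (real \<Rightarrow> 'a::real_normed_field) set)
           \<subseteq> hermite_spline_space w (h / m)"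
proof
  define k where "k = h / m"
  note k = refined_step[OF h m, folded k_def]
  fix f :: "real \<Rightarrow> 'a"
  assume "f \<in> hermite_spline_space w h"
  then obtain a :: "int \<Rightarrow> 'a^2" where a: "square_summable a"
    and f: "\<And>x. ((\<lambda>n. \<Sum>i\<in>UNIV. (phi_scaled w h (x - of_int n * h) $ i) *\<^sub>R (a n $ i))
                 has_sum f x) UNIV"
    unfolding hermite_spline_space_def square_summable_def by blast
  have hk: "h = m * k"
    using m by (simp add: k_def)
  let ?H = "refinement_mask w h m"
  define b :: "int \<Rightarrow> 'a^2" where
    "b l = (\<chi> c. \<Sum>n\<in>{l div int m, l div int m + 1}. \<Sum>i\<in>UNIV. (?H (l - int m * n) $ i $ c) *\<^sub>R (a n $ i))" for l
  have b_eq: "b l $ c = (\<Sum>n\<in>S. \<Sum>i\<in>UNIV. (?H (l - int m * n) $ i $ c) *\<^sub>R (a n $ i))"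
    if S: "finite S" "{l div int m, l div int m + 1} \<subseteq> S" for l c S
  proof -
    have "?H (l - int m * n) $ i $ c = 0" if "n \<notin> {l div int m, l div int m + 1}" for n i
    proof (rule refinement_mask_eq_0[OF h m])
      have "l = int m * (l div int m) + l mod int m" "0 \<le> l mod int m" "l mod int m < int m"
        using m by auto
      moreover have "n \<le> l div int m - 1 \<or> l div int m + 2 \<le> n"
        using that by auto
      then have "int m * n \<le> int m * (l div int m - 1) \<or> int m * (l div int m + 2) \<le> int m * n"
        using m by (auto intro: mult_left_mono)
      ultimately show "int m \<le> \<bar>l - int m * n\<bar>"
        unfolding right_diff_distrib distrib_left by linarith
    qed
    then show ?thesis
      unfolding b_def vec_lambda_beta by (intro sum.mono_neutral_left S) auto
  qed
  have "square_summable b"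
  proof (rule square_summable_residues)
    fix r :: int assume r: "0 \<le> r" "r < int m"
    then have d: "(int m * q + r) div int m = q" for q
      by simp
    have ai: "square_summable (\<lambda>q. a q $ i)" "square_summable (\<lambda>q. a (q + 1) $ i)" for i
      using a square_summable_shift[OF a, of 1] by (simp_all add: square_summable_vec2_iff)
    have "b (int m * q + r) $ c
        = ((?H r $ 1 $ c) *\<^sub>R (a q $ 1) + (?H r $ 2 $ c) *\<^sub>R (a q $ 2))
        + ((?H (r - int m) $ 1 $ c) *\<^sub>R (a (q + 1) $ 1) + (?H (r - int m) $ 2 $ c) *\<^sub>R (a (q + 1) $ 2))"
      for q c
      unfolding b_def d by (simp add: sum_2 algebra_simps)
    then show "square_summable (\<lambda>q. b (int m * q + r))"
      unfolding square_summable_vec2_iff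
      by (simp add: ai square_summable_add square_summable_scaleR)
  qed (use m in simp)
  moreover have "((\<lambda>l. \<Sum>c\<in>UNIV. (phi_scaled w k (x - of_int l * k) $ c) *\<^sub>R (b l $ c)) has_sum f x) UNIV"
    for x
  proof -
    define j where "j = \<lfloor>x / k\<rfloor>"
    \<comment> \<open>The cell of \<open>x\<close> has the end points \<open>j\<close> and \<open>j + 1\<close>, and \<open>(j + 1) div m\<close> may exceed \<open>j div m\<close>: the third
      index makes \<open>S\<close> contain the supports of the sums for both end points.\<close>
    define S where "S = {j div int m, j div int m + 1, j div int m + 2}"
    let ?G = "\<lambda>n i l c.
      (phi_scaled w k (x - of_int l * k) $ c) *\<^sub>R ((?H (l - int m * n) $ i $ c) *\<^sub>R (a n $ i))"
    have x: "of_int j * k \<le> x" "x \<le> (of_int j + 1) * k"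
      unfolding j_def using floor_cell[OF k(1)] by auto
    have fl: "\<lfloor>x / h\<rfloor> = j div int m"
      unfolding j_def hk using floor_divide_real_eq_div[of "int m" "x / k"] by (simp add: mult.commute)
    have "phi_scaled w h (x - of_int n * h) = 0" if "n \<notin> S" for n
      using that dist_outside_cell[OF h(1), of n x] unfolding S_def fl
      by (intro phi_scaled_eq_0[OF h]) auto
    then have "((\<lambda>n. \<Sum>i\<in>UNIV. (phi_scaled w h (x - of_int n * h) $ i) *\<^sub>R (a n $ i)) has_sum
        (\<Sum>n\<in>S. \<Sum>i\<in>UNIV. (phi_scaled w h (x - of_int n * h) $ i) *\<^sub>R (a n $ i))) UNIV"
      by (intro has_sum_finite_support) (auto simp: S_def)
    with f[of x] have "f x = (\<Sum>n\<in>S. \<Sum>i\<in>UNIV. (phi_scaled w h (x - of_int n * h) $ i) *\<^sub>R (a n $ i))"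
      by (rule has_sum_unique)
    also have "\<dots> = (\<Sum>n\<in>S. \<Sum>i\<in>UNIV. \<Sum>l\<in>{j, j + 1}. \<Sum>c\<in>UNIV. ?G n i l c)"
      unfolding phi_scaled_refinement[OF h m x[unfolded k_def]]
      by (simp only: k_def[symmetric] scaleR_sum_left scaleR_scaleR mult.commute)
    also have "\<dots> = (\<Sum>n\<in>S. \<Sum>l\<in>{j, j + 1}. \<Sum>i\<in>UNIV. \<Sum>c\<in>UNIV. ?G n i l c)"
      by (rule sum.cong[OF refl], rule sum.swap)
    also have "\<dots> = (\<Sum>l\<in>{j, j + 1}. \<Sum>n\<in>S. \<Sum>i\<in>UNIV. \<Sum>c\<in>UNIV. ?G n i l c)"
      by (rule sum.swap)
    also have "\<dots> = (\<Sum>l\<in>{j, j + 1}. \<Sum>n\<in>S. \<Sum>c\<in>UNIV. \<Sum>i\<in>UNIV. ?G n i l c)"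
      by (rule sum.cong[OF refl], rule sum.cong[OF refl], rule sum.swap)
    also have "\<dots> = (\<Sum>l\<in>{j, j + 1}. \<Sum>c\<in>UNIV. \<Sum>n\<in>S. \<Sum>i\<in>UNIV. ?G n i l c)"
      by (rule sum.cong[OF refl], rule sum.swap)
    also have "\<dots> = (\<Sum>l\<in>{j, j + 1}. \<Sum>c\<in>UNIV. (phi_scaled w k (x - of_int l * k) $ c) *\<^sub>R (b l $ c))"
    proof (intro sum.cong refl)
      fix l c assume l: "l \<in> {j, j + 1}"
      have "(j + 1) div int m \<le> j div int m + 1" "j div int m \<le> (j + 1) div int m"
      proof -
        have "(j + 1) div int m \<le> (j + int m) div int m"
          using m by (intro zdiv_mono1) auto
        then show "(j + 1) div int m \<le> j div int m + 1"
          using m by simp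
        show "j div int m \<le> (j + 1) div int m"
          using m by (intro zdiv_mono1) auto
      qed
      then have "{l div int m, l div int m + 1} \<subseteq> S"
        using l by (auto simp: S_def)
      then have "b l $ c = (\<Sum>n\<in>S. \<Sum>i\<in>UNIV. (?H (l - int m * n) $ i $ c) *\<^sub>R (a n $ i))"
        by (intro b_eq) (simp add: S_def)
      then show "(\<Sum>n\<in>S. \<Sum>i\<in>UNIV. ?G n i l c)
        = (phi_scaled w k (x - of_int l * k) $ c) *\<^sub>R (b l $ c)"
        by (simp only: scaleR_sum_right)
    qed
    finally have fx: "f x = \<dots>" .
    have "phi_scaled w k (x - of_int l * k) = 0" if "l \<notin> {j, j + 1}" for l
      using that dist_outside_cell[OF k(1), of l x] unfolding j_def
      by (intro phi_scaled_eq_0[OF k]) auto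
    then show ?thesis
      unfolding fx by (intro has_sum_finite_support) auto
  qed
  ultimately show "f \<in> hermite_spline_space w (h / m)"
    unfolding k_def[symmetric] hermite_spline_space_def square_summable_def by blast
qed

theorem mainTheorem3:
  fixes \<omega> h :: real and m :: nat
  assumes "0 \<le> \<omega>" and "\<omega> \<le> pi"
    and "h > 0" and "0 \<le> h * \<omega>" and "h * \<omega> \<le> pi"
    and "m > 1"
  shows "(hermite_spline_space \<omega> h :: (real \<Rightarrow> 'a::real_normed_field) set)
           \<subseteq> hermite_spline_space \<omega> (h / m) \<and>
         (\<forall>x. ((\<lambda>n. refinement_mask \<omega> h m n *v phi_scaled \<omega> (h / m) (x - of_int n * (h / m)))
              has_sum phi_scaled \<omega> h x) UNIV) \<and>
         (\<forall>n. refinement_mask \<omega> h m n =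
           vector [vector [phi1 (h * \<omega>) (of_int n / m), 1 / h * deriv (phi1 (h * \<omega>)) (of_int n / m)],
                   vector [h * phi2 (h * \<omega>) (of_int n / m), deriv (phi2 (h * \<omega>)) (of_int n / m)]])"
proof (intro conjI allI)
  note h = assms(3-5)
  have m: "m > 0"
    using assms by simp
  define k where "k = h / m"
  note k = refined_step[OF h m, folded k_def]
  show "(hermite_spline_space \<omega> h :: (real \<Rightarrow> 'a) set) \<subseteq> hermite_spline_space \<omega> (h / m)"
    by (rule hermite_spline_space_refine[OF h m])
  show "((\<lambda>n. refinement_mask \<omega> h m n *v phi_scaled \<omega> (h / m) (x - of_int n * (h / m)))
              has_sum phi_scaled \<omega> h x) UNIV" for x
  proof -
    define j where "j = \<lfloor>x / k\<rfloor>"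
    let ?F = "\<lambda>n. refinement_mask \<omega> h m n *v phi_scaled \<omega> k (x - of_int n * k)"
    have "phi_scaled \<omega> k (x - of_int l * k) = 0" if "l \<notin> {j, j + 1}" for l
      using that dist_outside_cell[OF k(1), of l x] unfolding j_def
      by (intro phi_scaled_eq_0[OF k]) auto
    then have "(?F has_sum sum ?F {j, j + 1}) UNIV"
      by (intro has_sum_finite_support) auto
    moreover have "phi_scaled \<omega> h x = sum ?F {j, j + 1}"
      using phi_scaled_refinement[OF h m floor_cell[OF k(1), of x, unfolded k_def], of 0]
      unfolding vec_eq_iff k_def[symmetric] j_def[symmetric]
      by (simp only: sum_component matrix_vector_mult_def vec_lambda_beta) simp
    ultimately show ?thesis
      by (simp add: k_def)
  qed
  show "refinement_mask \<omega> h m n =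
           vector [vector [phi1 (h * \<omega>) (of_int n / m), 1 / h * deriv (phi1 (h * \<omega>)) (of_int n / m)],
                   vector [h * phi2 (h * \<omega>) (of_int n / m), deriv (phi2 (h * \<omega>)) (of_int n / m)]]" for n
  proof -
    \<comment> \<open>The unscaled generators are the scaled ones of step 1 and frequency \<open>h \<omega>\<close>, so their
      differentiability is an instance of the scaled case.\<close>
    have unit: "phi1_scaled (h * \<omega>) 1 = phi1 (h * \<omega>)" "phi2_scaled (h * \<omega>) 1 = phi2 (h * \<omega>)"
      by (auto simp: phi1_scaled_def phi2_scaled_def)
    have "(phi1 (h * \<omega>) has_real_derivative deriv (phi1 (h * \<omega>)) x) (at x)"
      "(phi2 (h * \<omega>) has_real_derivative deriv (phi2 (h * \<omega>)) x) (at x)" for x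
      using phi_scaled_has_derivative[of 1 "h * \<omega>" 1 x] phi_scaled_has_derivative[of 1 "h * \<omega>" 2 x] h
      by (simp_all add: unit)
    note D = DERIV_chain2[OF this(1)] DERIV_chain2[OF this(2)]
    have "((\<lambda>x. x / h) has_real_derivative 1 / h) (at y)" for y
      using h(1) by (auto intro!: derivative_eq_intros)
    note D = D(1)[OF this] D(2)[OF this, THEN DERIV_cmult, of h]
    have "deriv (phi1_scaled \<omega> h) y = 1 / h * deriv (phi1 (h * \<omega>)) (y / h)"
      "deriv (phi2_scaled \<omega> h) y = deriv (phi2 (h * \<omega>)) (y / h)" for y
      unfolding phi1_scaled_def [abs_def] phi2_scaled_def [abs_def]
      using D[of y, THEN DERIV_imp_deriv] h(1) by simp_all
    moreover have "of_int n * (h / m) / h = of_int n / m"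
      using h(1) by simp
    ultimately show ?thesis
      unfolding refinement_mask_def phi1_scaled_def phi2_scaled_def by (simp only:)
  qed
qed

end
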